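(* Let $Z=\{z_1,\dots,z_N\}\subset\{0,1\}^n$ be a subset of size $N$ with distance distribution $(A_0,A_1,\dots,A_n)$. Then $$D^{L_2}(Z)=\Lambda_n-\frac1N\sum_{w=1}^n A_w\lambda(w),$$ where $\Lambda_n=\frac{n}{2^{n+1}}\binom{2n}{n}$ and $\lambda(w)=2^{n-w}w\binom{w-1}{\lceil w/2\rceil-1}$.
   Context: $d$ is the Hamming distance on $\{0,1\}^n$ and $B(x,t)=\{y: d(x,y)\le t\}$. The quadratic discrepancy is $D^{L_2}(Z)=\sum_{t=0}^n\sum_{x\in\{0,1\}^n}\Big(\frac1N\sum_{j=1}^N\mathbb 1_{B(x,t)}(z_j)-\frac{|B(x,t)|}{2^n}\Big)^2$. The distance distribution of $Z$ is $A_w=\frac1N|\{(z,z')\in Z^2: d(z,z')=w\}|$ (ordered pairs), $w=0,\dots,n$. *)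

theory Defs
  imports Complex_Main "HOL-Library.Indicator_Function"
begin

definition cube :: "nat \<Rightarrow> bool list set" where
  "cube n = {x. length x = n}"

text \<open>Intended for lists of equal length.\<close>

definition hamming :: "bool list \<Rightarrow> bool list \<Rightarrow> nat" where
  "hamming x y = card {i. i < length x \<and> x ! i \<noteq> y ! i}"

definition hball :: "nat \<Rightarrow> bool list \<Rightarrow> nat \<Rightarrow> bool list set" where
  "hball n x t = {y \<in> cube n. hamming x y \<le> t}"

definition discrepancy_L2 :: "nat \<Rightarrow> bool list set \<Rightarrow> real" where
  "discrepancy_L2 n Z =
     (\<Sum>t=0..n. \<Sum>x\<in>cube n.
        (1 / real (card Z) * (\<Sum>z\<in>Z. indicator (hball n x t) z)
          - real (card (hball n x t)) / 2 ^ n)\<^sup>2)"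

definition distance_distribution :: "bool list set \<Rightarrow> nat \<Rightarrow> real" where
  "distance_distribution Z w =
     1 / real (card Z) * real (card {(z, z'). z \<in> Z \<and> z' \<in> Z \<and> hamming z z' = w})"

definition Lambda_const :: "nat \<Rightarrow> real" where
  "Lambda_const n = real n / 2 ^ (n + 1) * real ((2 * n) choose n)"

text \<open>Only used for \<open>1 \<le> w \<le> n\<close>, where neither subtraction on \<^typ>\<open>nat\<close> truncates.\<close>

definition lambda_fun :: "nat \<Rightarrow> nat \<Rightarrow> real" where
  "lambda_fun n w =
     2 ^ (n - w) * real w * real ((w - 1) choose (nat \<lceil>real w / 2\<rceil> - 1))"

end

theory Submission
  imports Defs
begin

text \<open>
  Put \<open>c y = 1_Z y / N - 2^(-n)\<close>, a signed weight on the cube of total mass zero. The discrepancy is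
  the quadratic form of \<open>c\<close> for the kernel
  \<open>K y y' = \<Sum>x. (n + 1 - max (d x y) (d x y'))\<close>. Since \<open>max a b = (a + b + \<bar>a - b\<bar>) / 2\<close>, the
  kernel is a function of \<open>y\<close> plus a function of \<open>y'\<close> minus
  \<open>\<mu> y y' = (\<Sum>x. \<bar>d x y - d x y'\<bar>) / 2\<close>, and the first two are annihilated by \<open>c\<close>.
  Both \<open>\<mu> y y'\<close> and its (constant) row sums are absolute first moments of a simple random walk: in
  \<open>\<mu> y y'\<close> each coordinate where \<open>y\<close> and \<open>y'\<close> differ is one step of size 1, and in the row sum each
  coordinate is two steps of size 1/2. The absolute moment is evaluated by telescoping.
\<close>

section \<open>Moments of the simple random walk\<close>

text \<open>\<open>2 ^ m\<close> times the expectation of \<open>f\<close> at the endpoint of an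
  \<open>m\<close>-step simple random walk from 0; \<open>j\<close> counts the steps down. Leaving
  out the normalisation keeps it a plain count over sign patterns.\<close>

definition walk_sum :: "nat \<Rightarrow> (int \<Rightarrow> real) \<Rightarrow> real" where
  "walk_sum m f = (\<Sum>j\<le>m. real (m choose j) * f (int m - 2 * int j))"

lemma walk_sum_0 [simp]: "walk_sum 0 f = f 0"
  by (simp add: walk_sum_def)

lemma sum_choose_Suc:
  fixes g :: "nat \<Rightarrow> real"
  shows "(\<Sum>j\<le>Suc m. real (Suc m choose j) * g j) =
         (\<Sum>j\<le>m. real (m choose j) * g j) + (\<Sum>j\<le>m. real (m choose j) * g (Suc j))"
proof -
  have "(\<Sum>j\<le>Suc m. real (Suc m choose j) * g j) =
        g 0 + (\<Sum>j\<le>m. real (Suc m choose Suc j) * g (Suc j))"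
    by (subst sum.atMost_Suc_shift) simp
  also have "\<dots> = g 0 + (\<Sum>j\<le>m. real (m choose Suc j) * g (Suc j))
      + (\<Sum>j\<le>m. real (m choose j) * g (Suc j))"
    by (simp add: algebra_simps sum.distrib)
  also have "g 0 + (\<Sum>j\<le>m. real (m choose Suc j) * g (Suc j)) =
      (\<Sum>j\<le>Suc m. real (m choose j) * g j)"
    by (subst sum.atMost_Suc_shift) simp
  also have "\<dots> = (\<Sum>j\<le>m. real (m choose j) * g j)"
    by simp
  finally show ?thesis .
qed

text \<open>Conditioning on one step, which is Pascal's rule for the weights.\<close>

lemma walk_sum_Suc:
  "walk_sum (Suc m) f = walk_sum m (\<lambda>k. f (k + 1)) + walk_sum m (\<lambda>k. f (k - 1))"
  unfolding walk_sum_def sum_choose_Suc by (simp add: algebra_simps)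

text \<open>The sum telescopes: by absorption, the term at \<open>j > 0\<close> is
  \<open>Suc k\<close> times the difference of \<open>k choose j\<close> and
  \<open>k choose (j - 1)\<close>.\<close>

lemma sum_choose_times_deviation:
  "(\<Sum>j\<le>i. real (Suc k choose j) * (real (Suc k) - 2 * real j)) =
   real (Suc k) * real (k choose i)"
proof (induction i)
  case (Suc i)
  have absorb: "(1 + real i) * real (Suc k choose Suc i) = (1 + real k) * real (k choose i)"
    using Suc_times_binomial_eq[of k i]
    by (metis mult.commute of_nat_Suc of_nat_mult)
  have "(\<Sum>j\<le>Suc i. real (Suc k choose j) * (real (Suc k) - 2 * real j)) =
      real (Suc k) * real (k choose i)
      + (real (Suc k) * real (Suc k choose Suc i) - 2 * ((1 + real i) * real (Suc k choose Suc i)))"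
    using Suc.IH by (simp add: algebra_simps)
  also have "\<dots> = real (Suc k) * real (k choose Suc i)"
    unfolding absorb by (simp add: algebra_simps)
  finally show ?case .
qed simp

lemma walk_sum_abs_Suc:
  "walk_sum (Suc k) (\<lambda>i. \<bar>real_of_int i\<bar>) = 2 * real (Suc k) * real (k choose (k div 2))"
proof -
  let ?g = "\<lambda>j. real (Suc k choose j) * (real (Suc k) - 2 * real j)"
  \<comment> \<open>The positive part of \<open>?g\<close>, as \<open>2 * j < Suc k\<close> holds
    exactly when \<open>j \<le> k div 2\<close>. An absolute value is twice the positive part minus
    the value itself.\<close>
  let ?p = "\<lambda>j. if j \<le> k div 2 then ?g j else 0"
  have "walk_sum (Suc k) (\<lambda>i. \<bar>real_of_int i\<bar>) = (\<Sum>j\<le>Suc k. 2 * ?p j - ?g j)"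
    unfolding walk_sum_def
  proof (rule sum.cong)
    fix j
    show "real (Suc k choose j) * \<bar>real_of_int (int (Suc k) - 2 * int j)\<bar> = 2 * ?p j - ?g j"
    proof (cases "j \<le> k div 2")
      case True
      then have "real (2 * j) \<le> real (Suc k)" by (simp only: of_nat_le_iff)
      then show ?thesis using True by (simp add: abs_if)
    next
      case False
      then have "real (Suc k) \<le> real (2 * j)" by (simp only: of_nat_le_iff)
      then have "\<bar>real_of_int (int (Suc k) - 2 * int j)\<bar> = - (real (Suc k) - 2 * real j)" by simp
      then show ?thesis using False by (simp add: algebra_simps)
    qed
  qed simp
  also have "\<dots> = 2 * (\<Sum>j\<le>Suc k. ?p j) - (\<Sum>j\<le>Suc k. ?g j)"
    by (simp only: sum_subtractf sum_distrib_left)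
  \<comment> \<open>The telescoped sum over the full range ends in \<open>k choose Suc k\<close>,
    which is 0.\<close>
  also have "(\<Sum>j\<le>Suc k. ?g j) = 0"
    unfolding sum_choose_times_deviation by simp
  also have "(\<Sum>j\<le>Suc k. ?p j) = (\<Sum>j\<le>k div 2. ?g j)"
    by (rule sum.mono_neutral_cong_right) auto
  finally show ?thesis
    unfolding sum_choose_times_deviation by simp
qed

section \<open>Sums over the cube\<close>

lemma hamming_Nil [simp]: "hamming [] [] = 0"
  by (simp add: hamming_def)

lemma hamming_Cons [simp]:
  "hamming (a # x) (b # y) = of_bool (a \<noteq> b) + hamming x y"
proof -
  have "{i. i < length (a # x) \<and> (a # x) ! i \<noteq> (b # y) ! i} =
        (if a \<noteq> b then {0} else {}) \<union> Suc ` {i. i < length x \<and> x ! i \<noteq> y ! i}"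
  proof (rule set_eqI)
    show "i \<in> {i. i < length (a # x) \<and> (a # x) ! i \<noteq> (b # y) ! i} \<longleftrightarrow>
        i \<in> (if a \<noteq> b then {0} else {}) \<union> Suc ` {i. i < length x \<and> x ! i \<noteq> y ! i}" for i
      by (cases i) auto
  qed
  then show ?thesis
    by (simp add: hamming_def card_Un_disjoint card_image)
qed

lemma hamming_le_length: "hamming x y \<le> length x"
proof -
  have "hamming x y \<le> card {..<length x}"
    unfolding hamming_def by (rule card_mono) auto
  then show ?thesis by simp
qed

lemma cube_0 [simp]: "cube 0 = {[]}"
  by (simp add: cube_def)

lemma cube_Suc: "cube (Suc n) = (#) True ` cube n \<union> (#) False ` cube n"
  by (auto simp: cube_def length_Suc_conv image_iff)

lemma finite_cube [simp]: "finite (cube n)"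
  by (induction n) (simp_all add: cube_Suc)

lemma sum_cube_Suc:
  fixes F :: "bool list \<Rightarrow> real"
  shows "(\<Sum>x\<in>cube (Suc n). F x) = (\<Sum>x\<in>cube n. F (True # x)) + (\<Sum>x\<in>cube n. F (False # x))"
  unfolding cube_Suc by (subst sum.union_disjoint) (auto simp: sum.reindex inj_on_def)

lemma card_cube: "card (cube n) = 2 ^ n"
proof (induction n)
  case (Suc n)
  have "card (cube (Suc n)) = card ((#) True ` cube n) + card ((#) False ` cube n)"
    unfolding cube_Suc by (rule card_Un_disjoint) auto
  then show ?case using Suc.IH by (simp add: card_image)
qed simp

text \<open>A coordinate where \<open>y\<close> and \<open>z\<close> agree leaves the difference
  unchanged for both bits of \<open>x\<close>, giving a factor 2; one where they differ shifts it by
  1 or -1, a step of the walk.\<close>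

lemma sum_cube_distance_difference:
  assumes "length y = length z"
  shows "(\<Sum>x\<in>cube (length y). f (int (hamming x y) - int (hamming x z))) =
         2 ^ (length y - hamming y z) * walk_sum (hamming y z) f"
  using assms
proof (induction y z arbitrary: f rule: list_induct2)
  case (Cons a y b z)
  let ?d = "\<lambda>x. int (hamming x y) - int (hamming x z)"
  show ?case
  proof (cases "a = b")
    case True
    have "Suc (length y) - hamming y z = Suc (length y - hamming y z)"
      using hamming_le_length[of y z] by simp
    then show ?thesis
      using True Cons.IH[of f] by (simp add: sum_cube_Suc)
  next
    case False
    then have "(\<Sum>x\<in>cube (length (a # y)). f (int (hamming x (a # y)) - int (hamming x (b # z)))) =
        (\<Sum>x\<in>cube (length y). f (?d x + 1)) + (\<Sum>x\<in>cube (length y). f (?d x - 1))"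
      by (cases a; cases b) (simp_all add: sum_cube_Suc algebra_simps)
    then show ?thesis
      using False Cons.IH[of "\<lambda>k. f (k + 1)"] Cons.IH[of "\<lambda>k. f (k - 1)"]
      by (simp add: walk_sum_Suc algebra_simps)
  qed
qed simp

text \<open>Over the four choices of bits of \<open>x\<close> and \<open>z\<close>, a coordinate
  shifts the doubled difference by 2, 0, 0, -2: exactly the outcomes of two unit steps. The doubling
  keeps the steps integral.\<close>

lemma sum_cube_cube_distance_difference:
  "(\<Sum>z\<in>cube (length y). \<Sum>x\<in>cube (length y). f (2 * (int (hamming x y) - int (hamming x z)))) =
   walk_sum (2 * length y) f"
proof (induction y arbitrary: f)
  case (Cons a y)
  let ?d = "\<lambda>x z. 2 * (int (hamming x y) - int (hamming x z))"
  let ?S = "\<lambda>f :: int \<Rightarrow> real. \<Sum>z\<in>cube (length y). \<Sum>x\<in>cube (length y). f (?d x z)"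
  have "(\<Sum>z\<in>cube (length (a # y)). \<Sum>x\<in>cube (length (a # y)).
          f (2 * (int (hamming x (a # y)) - int (hamming x z)))) =
        ?S (\<lambda>k. f (k + 2)) + 2 * ?S f + ?S (\<lambda>k. f (k - 2))"
    by (cases a) (simp_all add: sum_cube_Suc sum.distrib algebra_simps)
  also have "\<dots> = walk_sum (2 * length (a # y)) f"
    unfolding Cons.IH[of f] Cons.IH[of "\<lambda>k. f (k + 2)"] Cons.IH[of "\<lambda>k. f (k - 2)"]
    by (simp add: walk_sum_Suc add.commute)
  finally show ?case .
qed simp

section \<open>The averaging kernel\<close>

text \<open>The function \<open>\<mu>\<close> of the overview, the part of the kernel that survives
  for weights of total mass zero.\<close>

definition half_distance_difference :: "nat \<Rightarrow> bool list \<Rightarrow> bool list \<Rightarrow> real" where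
  "half_distance_difference n y z =
     (\<Sum>x\<in>cube n. \<bar>real (hamming x y) - real (hamming x z)\<bar>) / 2"

lemma half_distance_difference_eq_lambda_fun:
  assumes "y \<in> cube n" "z \<in> cube n"
  shows "half_distance_difference n y z = lambda_fun n (hamming y z)"
proof -
  have len: "length y = n" "length z = n" using assms by (auto simp: cube_def)
  have *: "half_distance_difference n y z =
      2 ^ (n - hamming y z) * walk_sum (hamming y z) (\<lambda>i. \<bar>real_of_int i\<bar>) / 2"
    using sum_cube_distance_difference[of y z "\<lambda>i. \<bar>real_of_int i\<bar>"] len
    by (simp add: half_distance_difference_def)
  show ?thesis
  proof (cases "hamming y z")
    case 0
    then show ?thesis using * by (simp add: lambda_fun_def)
  next
    case (Suc k)
    \<comment> \<open>For \<open>w = Suc k\<close> these bounds identify the lower index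
      \<open>\<lceil>w / 2\<rceil> - 1\<close> in \<open>lambda_fun\<close> with
      \<open>k div 2\<close>.\<close>
    have "real (2 * (k div 2)) \<le> real k" "real (Suc k) \<le> real (2 * (k div 2) + 2)"
      by (simp_all only: of_nat_le_iff)
    then have "\<lceil>real (Suc k) / 2\<rceil> = int (k div 2) + 1"
      by (intro ceiling_unique) simp_all
    then have "nat \<lceil>real (Suc k) / 2\<rceil> - 1 = k div 2" by linarith
    then show ?thesis
      using * unfolding Suc walk_sum_abs_Suc lambda_fun_def by (simp add: algebra_simps)
  qed
qed

lemma sum_half_distance_difference:
  assumes "y \<in> cube n"
  shows "(\<Sum>z\<in>cube n. half_distance_difference n y z) = 2 ^ n * Lambda_const n"
proof -
  have len: "length y = n" using assms by (auto simp: cube_def)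
  \<comment> \<open>The 4 combines the 2 in \<open>half_distance_difference\<close> with the
    doubling that makes the steps integral.\<close>
  have "(\<Sum>z\<in>cube n. half_distance_difference n y z) =
      (\<Sum>z\<in>cube n. \<Sum>x\<in>cube n. \<bar>real_of_int (2 * (int (hamming x y) - int (hamming x z)))\<bar>) / 4"
  proof -
    have "\<bar>real_of_int (2 * (int (hamming x y) - int (hamming x z)))\<bar> =
        2 * \<bar>real (hamming x y) - real (hamming x z)\<bar>" for x z
      by (simp add: abs_if)
    then show ?thesis
      by (simp only: half_distance_difference_def flip: sum_distrib_left sum_divide_distrib)
  qed
  also have "\<dots> = walk_sum (2 * n) (\<lambda>i. \<bar>real_of_int i\<bar>) / 4"
    using sum_cube_cube_distance_difference[of "\<lambda>i. \<bar>real_of_int i\<bar>" y] len by simp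
  also have "\<dots> = 2 ^ n * Lambda_const n"
  proof (cases n)
    case 0
    then show ?thesis by (simp add: Lambda_const_def)
  next
    case (Suc m)
    \<comment> \<open>The two middle binomials of an odd row agree, and their sum is the central
      binomial of \<open>Lambda_const\<close>.\<close>
    have "(2 * m + 1) choose Suc m = (2 * m + 1) choose m"
      using binomial_symmetric[of m "2 * m + 1"] by simp
    then have "(2 * n) choose n = 2 * ((2 * m + 1) choose m)"
      by (simp add: Suc)
    moreover have "walk_sum (2 * n) (\<lambda>i. \<bar>real_of_int i\<bar>) =
        2 * real (2 * n) * real ((2 * m + 1) choose m)"
      using walk_sum_abs_Suc[of "2 * m + 1"] by (simp add: Suc)
    ultimately show ?thesis by (simp add: Lambda_const_def)
  qed
  finally show ?thesis .
qed

text \<open>Both points lie in the ball exactly for radii from the larger distance up to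
  \<open>n\<close>. Writing the maximum through the absolute difference isolates the only term that
  depends on both points.\<close>

lemma sum_hball_indicators:
  assumes "y \<in> cube n" "z \<in> cube n" "length x = n"
  shows "(\<Sum>t=0..n. indicator (hball n x t) y * indicator (hball n x t) z) =
     ((real n + 1) / 2 - real (hamming x y) / 2) + ((real n + 1) / 2 - real (hamming x z) / 2)
     - \<bar>real (hamming x y) - real (hamming x z)\<bar> / 2"
proof -
  let ?m = "max (hamming x y) (hamming x z)"
  have "?m \<le> n" using hamming_le_length[of x] assms(3) by simp
  have "(\<Sum>t=0..n. indicator (hball n x t) y * indicator (hball n x t) z) =
      (\<Sum>t=0..n. if ?m \<le> t then 1 else 0 :: real)"
    using assms by (intro sum.cong) (auto simp: hball_def indicator_def)
  also have "\<dots> = (\<Sum>t\<in>{?m..n}. 1)"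
    by (rule sum.mono_neutral_cong_right) auto
  also have "\<dots> = real n + 1 - real ?m" using \<open>?m \<le> n\<close> by (simp add: of_nat_diff)
  finally have "(\<Sum>t=0..n. indicator (hball n x t) y * indicator (hball n x t) z) =
      real n + 1 - real ?m" .
  moreover have "real ?m = (real (hamming x y) + real (hamming x z)
      + \<bar>real (hamming x y) - real (hamming x z)\<bar>) / 2"
    by (simp add: max_def)
  ultimately show ?thesis by (simp only:) (simp add: field_simps)
qed

section \<open>The quadratic form of a weight of total mass zero\<close>

lemma sum_ball_weights_squared:
  fixes c :: "bool list \<Rightarrow> real"
  assumes c0: "(\<Sum>y\<in>cube n. c y) = 0"
  shows "(\<Sum>t=0..n. \<Sum>x\<in>cube n. (\<Sum>y\<in>cube n. c y * indicator (hball n x t) y)\<^sup>2) =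
         - (\<Sum>y\<in>cube n. \<Sum>z\<in>cube n. c y * c z * half_distance_difference n y z)"
proof -
  let ?C = "cube n"
  define p where "p y = (\<Sum>x\<in>?C. (real n + 1) / 2 - real (hamming x y) / 2)" for y
  let ?i = "\<lambda>x t. indicator (hball n x t) :: bool list \<Rightarrow> real"
  have "(\<Sum>t=0..n. \<Sum>x\<in>?C. (\<Sum>y\<in>?C. c y * ?i x t y)\<^sup>2) =
      (\<Sum>t=0..n. \<Sum>x\<in>?C. \<Sum>y\<in>?C. \<Sum>z\<in>?C. c y * c z * (?i x t y * ?i x t z))"
    by (simp only: power2_eq_square sum_product mult_ac)
  \<comment> \<open>The next swaps move the centre \<open>x\<close> and the radius \<open>t\<close>
    inside, so that the kernel of the pair \<open>y\<close>, \<open>z\<close> appears.\<close>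
  also have "\<dots> = (\<Sum>x\<in>?C. \<Sum>t=0..n. \<Sum>y\<in>?C. \<Sum>z\<in>?C. c y * c z * (?i x t y * ?i x t z))"
    by (rule sum.swap)
  also have "\<dots> = (\<Sum>x\<in>?C. \<Sum>y\<in>?C. \<Sum>t=0..n. \<Sum>z\<in>?C. c y * c z * (?i x t y * ?i x t z))"
    by (rule sum.cong[OF refl], rule sum.swap)
  also have "\<dots> = (\<Sum>y\<in>?C. \<Sum>x\<in>?C. \<Sum>t=0..n. \<Sum>z\<in>?C. c y * c z * (?i x t y * ?i x t z))"
    by (rule sum.swap)
  also have "\<dots> = (\<Sum>y\<in>?C. \<Sum>x\<in>?C. \<Sum>z\<in>?C. \<Sum>t=0..n. c y * c z * (?i x t y * ?i x t z))"
    by (rule sum.cong[OF refl], rule sum.cong[OF refl], rule sum.swap)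
  also have "\<dots> = (\<Sum>y\<in>?C. \<Sum>z\<in>?C. \<Sum>x\<in>?C. \<Sum>t=0..n. c y * c z * (?i x t y * ?i x t z))"
    by (rule sum.cong[OF refl], rule sum.swap)
  also have "\<dots> = (\<Sum>y\<in>?C. \<Sum>z\<in>?C. c y * c z * (\<Sum>x\<in>?C. \<Sum>t=0..n. ?i x t y * ?i x t z))"
    by (simp only: sum_distrib_left)
  also have "\<dots> = (\<Sum>y\<in>?C. \<Sum>z\<in>?C. c y * c z * (p y + p z - half_distance_difference n y z))"
  proof (intro sum.cong refl arg_cong2[where f = "(*)"])
    fix y z assume yz: "y \<in> ?C" "z \<in> ?C"
    have "(\<Sum>x\<in>?C. \<Sum>t=0..n. ?i x t y * ?i x t z) =
        (\<Sum>x\<in>?C. ((real n + 1) / 2 - real (hamming x y) / 2)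
          + ((real n + 1) / 2 - real (hamming x z) / 2)
          - \<bar>real (hamming x y) - real (hamming x z)\<bar> / 2)"
      by (rule sum.cong[OF refl], rule sum_hball_indicators) (use yz in \<open>auto simp: cube_def\<close>)
    also have "\<dots> = p y + p z - half_distance_difference n y z"
      by (simp only: p_def half_distance_difference_def sum.distrib sum_subtractf sum_divide_distrib)
    finally show "(\<Sum>x\<in>?C. \<Sum>t=0..n. ?i x t y * ?i x t z) = \<dots>" .
  qed
  also have "\<dots> = (\<Sum>y\<in>?C. \<Sum>z\<in>?C. (c y * p y) * c z) + (\<Sum>y\<in>?C. \<Sum>z\<in>?C. c y * (c z * p z))
      - (\<Sum>y\<in>?C. \<Sum>z\<in>?C. c y * c z * half_distance_difference n y z)"
    by (simp add: algebra_simps sum.distrib sum_subtractf)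
  \<comment> \<open>In each one-point part the total mass of \<open>c\<close> splits off as a
    factor.\<close>
  also have "(\<Sum>y\<in>?C. \<Sum>z\<in>?C. (c y * p y) * c z) = 0"
    by (simp add: c0 flip: sum_distrib_left)
  also have "(\<Sum>y\<in>?C. \<Sum>z\<in>?C. c y * (c z * p z)) = 0"
    by (simp add: c0 flip: sum_product)
  finally show ?thesis by simp
qed

section \<open>The centred weight of a subset of the cube\<close>

lemma sum_centered_weight:
  fixes g :: "bool list \<Rightarrow> real"
  assumes "Z \<subseteq> cube n"
  shows "(\<Sum>y\<in>cube n. (indicator Z y / a - 1 / b) * g y) =
         (\<Sum>z\<in>Z. g z) / a - (\<Sum>y\<in>cube n. g y) / b"
proof -
  have "(\<Sum>y\<in>cube n. indicator Z y * g y) = (\<Sum>z\<in>Z. g z)"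
    using assms by (intro sum.mono_neutral_cong_right) (auto simp: indicator_def)
  moreover have "(\<Sum>y\<in>cube n. (indicator Z y / a - 1 / b) * g y) =
      (\<Sum>y\<in>cube n. indicator Z y * g y) / a - (\<Sum>y\<in>cube n. g y) / b"
    by (simp only: left_diff_distrib sum_subtractf sum_divide_distrib times_divide_eq_left mult_1)
  ultimately show ?thesis by simp
qed

lemma discrepancy_L2_eq_pair_sum:
  assumes Z: "Z \<subseteq> cube n" and "card Z \<ge> 1"
  shows "discrepancy_L2 n Z =
         Lambda_const n - (\<Sum>y\<in>Z. \<Sum>z\<in>Z. half_distance_difference n y z) / (real (card Z))\<^sup>2"
proof -
  let ?C = "cube n" and ?N = "real (card Z)" and ?h = "half_distance_difference n"
  define c where "c y = indicator Z y / ?N - 1 / 2 ^ n" for y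
  have N: "?N \<noteq> 0" using assms(2) by simp
  have c_sum: "(\<Sum>y\<in>?C. c y * g y) = (\<Sum>z\<in>Z. g z) / ?N - (\<Sum>y\<in>?C. g y) / 2 ^ n" for g
    unfolding c_def using Z by (rule sum_centered_weight)
  have c0: "(\<Sum>y\<in>?C. c y) = 0"
    using c_sum[of "\<lambda>_. 1"] N by (simp add: card_cube)
  have ball: "(\<Sum>y\<in>?C. indicator (hball n x t) y :: real) = real (card (hball n x t))" for x t
  proof -
    have "(\<Sum>y\<in>?C. indicator (hball n x t) y :: real) = (\<Sum>y\<in>hball n x t. 1)"
      by (rule sum.mono_neutral_cong_right) (auto simp: hball_def)
    then show ?thesis by simp
  qed
  have row: "(\<Sum>z\<in>?C. c y * c z * ?h y z) = c y * ((\<Sum>z\<in>Z. ?h y z) / ?N - Lambda_const n)"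
    if "y \<in> ?C" for y
    using c_sum[of "?h y"] sum_half_distance_difference[OF that]
    by (simp add: mult.assoc flip: sum_distrib_left)
  \<comment> \<open>Symmetry of the kernel turns this into row sums, which all have the same
    value.\<close>
  have col: "(\<Sum>y\<in>?C. \<Sum>z\<in>Z. ?h y z) = ?N * 2 ^ n * Lambda_const n"
  proof -
    have sym: "?h y z = ?h z y" for y z
      by (simp add: half_distance_difference_def abs_minus_commute)
    have "(\<Sum>y\<in>?C. \<Sum>z\<in>Z. ?h y z) = (\<Sum>z\<in>Z. \<Sum>y\<in>?C. ?h z y)"
      by (subst sum.swap) (simp add: sym)
    also have "\<dots> = (\<Sum>z\<in>Z. 2 ^ n * Lambda_const n)"
      using Z by (intro sum.cong refl sum_half_distance_difference) auto
    finally show ?thesis by simp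
  qed
  have "discrepancy_L2 n Z =
      (\<Sum>t=0..n. \<Sum>x\<in>?C. (\<Sum>y\<in>?C. c y * indicator (hball n x t) y)\<^sup>2)"
    by (simp add: discrepancy_L2_def c_sum ball)
  also have "\<dots> = - (\<Sum>y\<in>?C. \<Sum>z\<in>?C. c y * c z * ?h y z)"
    by (rule sum_ball_weights_squared[OF c0])
  also have "\<dots> = - (\<Sum>y\<in>?C. c y * ((\<Sum>z\<in>Z. ?h y z) / ?N - Lambda_const n))"
    by (simp add: row)
  \<comment> \<open>The constant \<open>Lambda_const n\<close> is annihilated by \<open>c\<close>;
    it returns in the next step from the uniform part of \<open>c\<close>, through
    \<open>col\<close>.\<close>
  also have "\<dots> = - (\<Sum>y\<in>?C. c y * (\<Sum>z\<in>Z. ?h y z)) / ?N"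
    using c0 by (simp add: right_diff_distrib sum_subtractf
        flip: sum_distrib_right sum_divide_distrib)
  also have "\<dots> =
      Lambda_const n - (\<Sum>y\<in>Z. \<Sum>z\<in>Z. ?h y z) / ?N\<^sup>2"
    unfolding c_sum col using N by (simp add: field_simps power2_eq_square)
  finally show ?thesis .
qed

section \<open>Grouping ordered pairs by distance\<close>

lemma sum_distance_distribution:
  fixes f :: "nat \<Rightarrow> real"
  assumes Z: "Z \<subseteq> cube n"
  shows "(\<Sum>w=0..n. distance_distribution Z w * f w) =
         (\<Sum>y\<in>Z. \<Sum>z\<in>Z. f (hamming y z)) / real (card Z)"
proof -
  let ?d = "\<lambda>p. hamming (fst p) (snd p)"
  have fin: "finite (Z \<times> Z)" using Z finite_subset[OF _ finite_cube] by blast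
  \<comment> \<open>No distance exceeds \<open>n\<close>, so the grouping loses no pair.\<close>
  have im: "?d ` (Z \<times> Z) \<subseteq> {0..n}"
    using Z hamming_le_length by (fastforce simp: cube_def)
  have "(\<Sum>y\<in>Z. \<Sum>z\<in>Z. f (hamming y z)) = (\<Sum>p\<in>Z \<times> Z. f (?d p))"
    by (simp add: sum.cartesian_product case_prod_unfold)
  also have "\<dots> = (\<Sum>w\<in>{0..n}. \<Sum>p\<in>{p \<in> Z \<times> Z. ?d p = w}. f (?d p))"
    using sum.group[OF fin _ im, of "\<lambda>p. f (?d p)"] by simp
  also have "\<dots> = (\<Sum>w=0..n. real (card {(y, z). y \<in> Z \<and> z \<in> Z \<and> hamming y z = w}) * f w)"
  proof (rule sum.cong[OF refl])
    fix w
    have "{(y, z). y \<in> Z \<and> z \<in> Z \<and> hamming y z = w} = {p \<in> Z \<times> Z. ?d p = w}" by auto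
    then show "(\<Sum>p\<in>{p \<in> Z \<times> Z. ?d p = w}. f (?d p)) =
        real (card {(y, z). y \<in> Z \<and> z \<in> Z \<and> hamming y z = w}) * f w" by simp
  qed
  finally show ?thesis
    by (simp add: distance_distribution_def sum_divide_distrib)
qed

theorem theorem3p3:
  fixes n N :: nat and Z :: "bool list set"
  assumes "Z \<subseteq> cube n" and "card Z = N" and "N \<ge> 1"
  shows "discrepancy_L2 n Z =
           Lambda_const n
             - 1 / real N * (\<Sum>w=1..n. distance_distribution Z w * lambda_fun n w)"
proof -
  have "(\<Sum>y\<in>Z. \<Sum>z\<in>Z. half_distance_difference n y z) =
      (\<Sum>y\<in>Z. \<Sum>z\<in>Z. lambda_fun n (hamming y z))"
    using assms(1) by (intro sum.cong refl half_distance_difference_eq_lambda_fun) auto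
  also have "\<dots> = real N * (\<Sum>w=0..n. distance_distribution Z w * lambda_fun n w)"
    unfolding sum_distance_distribution[OF assms(1)] using assms by simp
  \<comment> \<open>The diagonal pairs sit at \<open>w = 0\<close>, where the factor
    \<open>real w\<close> makes \<open>lambda_fun\<close> vanish.\<close>
  also have "(\<Sum>w=0..n. distance_distribution Z w * lambda_fun n w) =
      (\<Sum>w=1..n. distance_distribution Z w * lambda_fun n w)"
    by (subst sum.atLeast_Suc_atMost) (simp_all add: lambda_fun_def)
  finally show ?thesis
    using discrepancy_L2_eq_pair_sum[OF assms(1)] assms by (simp add: power2_eq_square)
qed

end
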